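(* Suppose that $$f_\alpha(x,y,\mathbf 0)\le0,\qquad g_\alpha(x,y)\ge0,\qquad\alpha=1,2,$$ and that there exist positive constants $K_1,K_2$ such that, with $K=(K_1,K_2)$, $$f_\alpha(x,y,K)\ge0,\ (x,y)\in\overline\omega,\qquad g_\alpha(x,y)\le K_\alpha,\ (x,y)\in\partial\omega,\qquad\alpha=1,2.$$ Let $\widehat U(x_i,y_j)=0$ and $\widetilde U(x_i,y_j)=K$ for $(x_i,y_j)\in\overline\Omega^h$. Then $\widehat U=(\widehat U_1,\widehat U_2)$ and $\widetilde U=(\widetilde U_1,\widetilde U_2)$ are, respectively, ordered lower and upper solutions of the nonlinear difference scheme (defined in the context), and they satisfy $$\widehat U(x_i,y_j)\le\widetilde U(x_i,y_j),\qquad (x_i,y_j)\in\overline\Omega^h.$$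
   Context: Let $\omega=(0,1)\times(0,1)$, let $\varepsilon_1,\varepsilon_2>0$ be constants, and let $v_\alpha(x,y)\ge0$ on $\overline\omega$, $f_\alpha(x,y,u)$ ($(x,y)\in\overline\omega$, $u=(u_1,u_2)$), and $g=(g_1,g_2)$ on $\partial\omega$, $\alpha=1,2$, be smooth functions. Inequalities between vectors and vector functions are understood componentwise. Mesh: $\overline\Omega^h=\{(x_i,y_j):0\le i\le N_x,\ 0\le j\le N_y\}$ with $x_i=ih_x$, $y_j=jh_y$, $h_x=1/N_x$, $h_y=1/N_y$; $\Omega^h$ is the set of interior mesh points ($1\le i\le N_x-1$, $1\le j\le N_y-1$) and $\partial\Omega^h=\overline\Omega^h\setminus\Omega^h$. For a mesh function $U=(U_1,U_2)$ put $U_{\alpha,ij}=U_\alpha(x_i,y_j)$. For an interior mesh point define $$\mathcal L_{\alpha,ij}U_\alpha(x_i,y_j)=-\varepsilon_\alpha\left(\frac{U_{\alpha,i-1,j}-2U_{\alpha,ij}+U_{\alpha,i+1,j}}{h_x^2}+\frac{U_{\alpha,i,j-1}-2U_{\alpha,ij}+U_{\alpha,i,j+1}}{h_y^2}\right)+v_\alpha(x_i,y_j)\left(\frac{U_{\alpha,ij}-U_{\alpha,i-1,j}}{h_x}+\frac{U_{\alpha,ij}-U_{\alpha,i,j-1}}{h_y}\right).$$ The nonlinear difference scheme is $$\mathcal L_{\alpha,ij}U_\alpha(x_i,y_j)+f_\alpha(x_i,y_j,U)=0,\ (x_i,y_j)\in\Omega^h,\ \alpha=1,2;\qquad U(x_i,y_j)=g(x_i,y_j),\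 (x_i,y_j)\in\partial\Omega^h.$$ Mesh functions $\widetilde U=(\widetilde U_1,\widetilde U_2)$ and $\widehat U=(\widehat U_1,\widehat U_2)$ are ordered upper and lower solutions of this scheme if $\widetilde U\ge\widehat U$ on $\overline\Omega^h$; $\mathcal L_{\alpha,ij}\widetilde U_\alpha(x_i,y_j)+f_\alpha(x_i,y_j,\widetilde U)\ge0$ and $\mathcal L_{\alpha,ij}\widehat U_\alpha(x_i,y_j)+f_\alpha(x_i,y_j,\widehat U)\le0$ on $\Omega^h$ for $\alpha=1,2$; and $\widehat U\le g\le\widetilde U$ on $\partial\Omega^h$. *)

theory Defs
  imports "HOL-Analysis.Analysis"
begin

text \<open>
  The two components are indexed by the two-element type \<open>2\<close>, so vectors are elements of
  \<open>real ^ 2\<close>, whose library order \<open>\<le>\<close> is the componentwise one (\<open>less_eq_vec_def\<close>).  The library's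
  strict order \<open><\<close> on vectors is not componentwise strict and is not used.
\<close>

fun Ck_on :: "nat \<Rightarrow> 'a::euclidean_space set \<Rightarrow> ('a \<Rightarrow> 'b::real_normed_vector) \<Rightarrow> bool" where
  "Ck_on 0 T F \<longleftrightarrow> continuous_on T F"
| "Ck_on (Suc k) T F \<longleftrightarrow>
     (\<forall>x\<in>T. F differentiable (at x)) \<and>
     (\<forall>d. Ck_on k T (\<lambda>x. frechet_derivative F (at x) d))"

text \<open>
  Smoothness on a set that need not be open means, as usual, being the restriction of a
  \<open>C\<close>-infinity function on an open superset.  On the boundary of the unit square this is the same as
  being continuous and smooth along each of the four closed edges (near a corner, functions \<open>a\<close> and
  \<open>b\<close> on the two edges with a common corner value \<open>c\<close> extend as \<open>a x + b y - c\<close>).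
\<close>

definition smooth_on :: "'a::euclidean_space set \<Rightarrow> ('a \<Rightarrow> 'b::real_normed_vector) \<Rightarrow> bool" where
  "smooth_on S F \<longleftrightarrow>
     (\<exists>T G. open T \<and> S \<subseteq> T \<and> (\<forall>k. Ck_on k T G) \<and> (\<forall>x\<in>S. G x = F x))"

definition omega :: "(real \<times> real) set" where
  "omega = {0<..<1} \<times> {0<..<1}"

definition mesh_point :: "nat \<Rightarrow> nat \<Rightarrow> nat \<Rightarrow> nat \<Rightarrow> real \<times> real" where
  "mesh_point Nx Ny i j = (real i * (1 / real Nx), real j * (1 / real Ny))"

definition closed_mesh :: "nat \<Rightarrow> nat \<Rightarrow> (real \<times> real) set" where
  "closed_mesh Nx Ny = {mesh_point Nx Ny i j | i j. 0 \<le> i \<and> i \<le> Nx \<and> 0 \<le> j \<and> j \<le> Ny}"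

definition interior_mesh :: "nat \<Rightarrow> nat \<Rightarrow> (real \<times> real) set" where
  "interior_mesh Nx Ny =
     {mesh_point Nx Ny i j | i j. 1 \<le> i \<and> i \<le> Nx - 1 \<and> 1 \<le> j \<and> j \<le> Ny - 1}"

definition boundary_mesh :: "nat \<Rightarrow> nat \<Rightarrow> (real \<times> real) set" where
  "boundary_mesh Nx Ny = closed_mesh Nx Ny - interior_mesh Nx Ny"

text \<open>
  A mesh function is given as a function on the plane of which only the values on the closed mesh
  matter.  The operator below is only meaningful for interior indices; there the truncated
  subtraction \<open>i - 1\<close> is the true one.
\<close>

definition diff_op ::
  "nat \<Rightarrow> nat \<Rightarrow> real ^ 2 \<Rightarrow> (real \<times> real \<Rightarrow> real ^ 2) \<Rightarrow> 2 \<Rightarrow> nat \<Rightarrow> nat \<Rightarrow>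
   (real \<times> real \<Rightarrow> real ^ 2) \<Rightarrow> real" where
  "diff_op Nx Ny \<epsilon> v \<alpha> i j U =
     (let hx = 1 / real Nx; hy = 1 / real Ny;
          u = (\<lambda>k l. U (mesh_point Nx Ny k l) $ \<alpha>)
      in - (\<epsilon> $ \<alpha>) * ((u (i - 1) j - 2 * u i j + u (i + 1) j) / hx\<^sup>2
                     + (u i (j - 1) - 2 * u i j + u i (j + 1)) / hy\<^sup>2)
         + v (mesh_point Nx Ny i j) $ \<alpha>
             * ((u i j - u (i - 1) j) / hx + (u i j - u i (j - 1)) / hy))"

text \<open>
  Left-hand side of the scheme at the interior mesh point with indices \<open>i\<close>, \<open>j\<close>; the reaction
  term is evaluated at the value of \<open>U\<close> at that same point.
\<close>

definition scheme_lhs ::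
  "nat \<Rightarrow> nat \<Rightarrow> real ^ 2 \<Rightarrow> (real \<times> real \<Rightarrow> real ^ 2) \<Rightarrow>
   (real \<times> real \<Rightarrow> real ^ 2 \<Rightarrow> real ^ 2) \<Rightarrow> 2 \<Rightarrow> nat \<Rightarrow> nat \<Rightarrow>
   (real \<times> real \<Rightarrow> real ^ 2) \<Rightarrow> real" where
  "scheme_lhs Nx Ny \<epsilon> v f \<alpha> i j U =
     diff_op Nx Ny \<epsilon> v \<alpha> i j U
     + f (mesh_point Nx Ny i j) (U (mesh_point Nx Ny i j)) $ \<alpha>"

definition ordered_upper_lower_solutions ::
  "nat \<Rightarrow> nat \<Rightarrow> real ^ 2 \<Rightarrow> (real \<times> real \<Rightarrow> real ^ 2) \<Rightarrow>
   (real \<times> real \<Rightarrow> real ^ 2 \<Rightarrow> real ^ 2) \<Rightarrow> (real \<times> real \<Rightarrow> real ^ 2) \<Rightarrow>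
   (real \<times> real \<Rightarrow> real ^ 2) \<Rightarrow> (real \<times> real \<Rightarrow> real ^ 2) \<Rightarrow> bool" where
  "ordered_upper_lower_solutions Nx Ny \<epsilon> v f g Upper Lower \<longleftrightarrow>
     (\<forall>p\<in>closed_mesh Nx Ny. Lower p \<le> Upper p) \<and>
     (\<forall>\<alpha> i j. 1 \<le> i \<and> i \<le> Nx - 1 \<and> 1 \<le> j \<and> j \<le> Ny - 1 \<longrightarrow>
        scheme_lhs Nx Ny \<epsilon> v f \<alpha> i j Upper \<ge> 0 \<and>
        scheme_lhs Nx Ny \<epsilon> v f \<alpha> i j Lower \<le> 0) \<and>
     (\<forall>p\<in>boundary_mesh Nx Ny. Lower p \<le> g p \<and> g p \<le> Upper p)"

end

theory Submission
  imports Defs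
begin

text \<open>The difference operator is built from differences of neighbouring values, so it
  annihilates constants. For a constant mesh function the scheme therefore reduces to the reaction
  term (\<open>scheme_lhs_constant\<close>), and the signs of \<open>f\<close> at \<open>0\<close>
  and at \<open>K\<close> are exactly the lower and upper solution inequalities. The boundary
  inequalities are the bounds on \<open>g\<close>, which apply because mesh boundary points lie on
  the boundary of the square (\<open>boundary_mesh_subset_frontier\<close>).\<close>

lemma closure_omega: "closure omega = {0..1} \<times> {0..1}"
  by (simp add: omega_def closure_Times)

lemma frontier_omega: "frontier omega = {0..1} \<times> {0..1} - {0<..<1} \<times> {0<..<1}"
  by (simp add: frontier_def closure_omega)
     (simp add: omega_def interior_open open_Times)

lemma closed_mesh_iff:
  "p \<in> closed_mesh Nx Ny \<longleftrightarrow> (\<exists>i\<le>Nx. \<exists>j\<le>Ny. p = mesh_point Nx Ny i j)"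
  by (auto simp: closed_mesh_def)

lemma mesh_point_in_closure_omega:
  assumes "i \<le> Nx" "j \<le> Ny"
  shows "mesh_point Nx Ny i j \<in> closure omega"
  \<comment> \<open>If \<open>Nx = 0\<close>, the bound forces \<open>i = 0\<close> and the
    coordinate is 0, still in the unit interval; likewise for \<open>Ny\<close>.\<close>
  using assms by (auto simp: closure_omega mesh_point_def divide_le_eq_1)

text \<open>A closed mesh point that is not interior has an extreme index, so one of its coordinates
  is 0 or 1.\<close>

lemma boundary_mesh_subset_frontier:
  assumes "Nx \<ge> 1" "Ny \<ge> 1"
  shows "boundary_mesh Nx Ny \<subseteq> frontier omega"
proof
  fix p assume p: "p \<in> boundary_mesh Nx Ny"
  then obtain i j where ij: "i \<le> Nx" "j \<le> Ny" "p = mesh_point Nx Ny i j"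
    by (auto simp: boundary_mesh_def closed_mesh_iff)
  \<comment> \<open>Membership in \<open>interior_mesh\<close> is existential over indices, so the
    chosen pair cannot be an interior one; injectivity of \<open>mesh_point\<close> does not
    enter.\<close>
  have "\<not> (1 \<le> i \<and> i \<le> Nx - 1 \<and> 1 \<le> j \<and> j \<le> Ny - 1)"
    using p ij(3) by (auto simp: boundary_mesh_def interior_mesh_def)
  then have "i = 0 \<or> i = Nx \<or> j = 0 \<or> j = Ny"
    using ij(1,2) by linarith
  then have "p \<notin> {0<..<1} \<times> {0<..<1}"
    using assms by (auto simp: ij(3) mesh_point_def)
  then show "p \<in> frontier omega"
    using mesh_point_in_closure_omega[OF ij(1,2)]
    by (simp add: ij(3) frontier_omega closure_omega)
qed

text \<open>All five stencil values equal \<open>c\<close>, so the second differences and the upwind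
  differences vanish. Since \<open>U\<close> is known only on the closed mesh, the stencil of an
  interior point must be shown to stay there.\<close>

lemma scheme_lhs_constant:
  assumes "\<forall>p\<in>closed_mesh Nx Ny. U p = c"
    and "1 \<le> i" "i \<le> Nx - 1" "1 \<le> j" "j \<le> Ny - 1"
  shows "scheme_lhs Nx Ny \<epsilon> v f \<alpha> i j U = f (mesh_point Nx Ny i j) c $ \<alpha>"
proof -
  have U: "U (mesh_point Nx Ny k l) = c" if "k \<le> Nx" "l \<le> Ny" for k l
    using assms(1) that closed_mesh_iff by blast
  \<comment> \<open>From \<open>1 \<le> i\<close> and \<open>i \<le> Nx - 1\<close> follows
    \<open>Nx \<ge> 2\<close>, so the truncated subtraction is exact and
    \<open>i + 1 \<le> Nx\<close>.\<close>
  have "i - 1 \<le> Nx" "i \<le> Nx" "i + 1 \<le> Nx" "j - 1 \<le> Ny" "j \<le> Ny" "j + 1 \<le> Ny"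
    using assms(2-5) by linarith+
  then show ?thesis
    \<comment> \<open>Leaving \<open>1\<close> unexpanded keeps the neighbours as
      \<open>i - 1\<close> and \<open>i + 1\<close>, the form in which the index bounds are
      stated.\<close>
    by (simp add: scheme_lhs_def diff_op_def Let_def U del: Suc_eq_plus1 One_nat_def)
qed

theorem lemma4:
  fixes Nx Ny :: nat
    and \<epsilon> K :: "real ^ 2"
    and v g :: "real \<times> real \<Rightarrow> real ^ 2"
    and f :: "real \<times> real \<Rightarrow> real ^ 2 \<Rightarrow> real ^ 2"
    and Uhat Utilde :: "real \<times> real \<Rightarrow> real ^ 2"
  assumes "Nx \<ge> 1" and "Ny \<ge> 1"
    and "\<forall>\<alpha>. \<epsilon> $ \<alpha> > 0"
    and "\<forall>\<alpha>. smooth_on (closure omega) (\<lambda>p. v p $ \<alpha>)"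
    and "\<forall>p\<in>closure omega. \<forall>\<alpha>. v p $ \<alpha> \<ge> 0"
    and "\<forall>\<alpha>. smooth_on (closure omega \<times> UNIV) (\<lambda>(p, u). f p u $ \<alpha>)"
    and "\<forall>\<alpha>. smooth_on (frontier omega) (\<lambda>p. g p $ \<alpha>)"
    and "\<forall>p\<in>closure omega. \<forall>\<alpha>. f p 0 $ \<alpha> \<le> 0"
    and "\<forall>p\<in>frontier omega. \<forall>\<alpha>. g p $ \<alpha> \<ge> 0"
    and "\<forall>\<alpha>. K $ \<alpha> > 0"
    and "\<forall>p\<in>closure omega. \<forall>\<alpha>. f p K $ \<alpha> \<ge> 0"
    and "\<forall>p\<in>frontier omega. \<forall>\<alpha>. g p $ \<alpha> \<le> K $ \<alpha>"
    and "\<forall>p\<in>closed_mesh Nx Ny. Uhat p = 0"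
    and "\<forall>p\<in>closed_mesh Nx Ny. Utilde p = K"
  shows "ordered_upper_lower_solutions Nx Ny \<epsilon> v f g Utilde Uhat \<and>
         (\<forall>p\<in>closed_mesh Nx Ny. Uhat p \<le> Utilde p)"
proof -
  have le: "\<forall>p\<in>closed_mesh Nx Ny. Uhat p \<le> Utilde p"
    using assms(10,13,14) by (simp add: less_eq_vec_def less_imp_le)
  have inner: "scheme_lhs Nx Ny \<epsilon> v f \<alpha> i j Utilde \<ge> 0 \<and> scheme_lhs Nx Ny \<epsilon> v f \<alpha> i j Uhat \<le> 0"
    if ij: "1 \<le> i" "i \<le> Nx - 1" "1 \<le> j" "j \<le> Ny - 1" for \<alpha> i j
  proof -
    \<comment> \<open>The sign conditions on \<open>f\<close> are given on the closed square, so
      they hold at this point, where the two residuals are the values of \<open>f\<close> at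
      \<open>K\<close> and at \<open>0\<close>.\<close>
    have "mesh_point Nx Ny i j \<in> closure omega"
      using ij by (intro mesh_point_in_closure_omega) linarith+
    then show ?thesis
      using assms(8,11) by (simp add: scheme_lhs_constant[OF assms(13) ij] scheme_lhs_constant[OF assms(14) ij])
  qed
  have "Uhat p \<le> g p \<and> g p \<le> Utilde p" if p: "p \<in> boundary_mesh Nx Ny" for p
  proof -
    have "p \<in> frontier omega"
      using boundary_mesh_subset_frontier[OF assms(1,2)] p by blast
    moreover have "p \<in> closed_mesh Nx Ny"
      using p by (simp add: boundary_mesh_def)
    ultimately show ?thesis
      using assms(9,12,13,14) by (simp add: less_eq_vec_def)
  qed
  with le inner show ?thesis
    by (simp add: ordered_upper_lower_solutions_def)
qed

end
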